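(* Let $n\ge1$, $1<p<\infty$ and let $w$ be a weight on $\mathbb{R}^{n+1}$. The following conditions are equivalent. (i) $w\in RH^+_\infty$. (ii) There exists a constant $C$ such that $$\frac{w(E)}{w(R^+)}\le C\,\frac{|E|}{|R^-|}$$ for every parabolic rectangle $R\subset\mathbb{R}^{n+1}$ and every measurable set $E\subset R^-$. (iii) There exists a constant $C$ such that $$M^+(w\chi_{R^-})(x,t)\le C\,w_{R^+}$$ for every parabolic rectangle $R\subset\mathbb{R}^{n+1}$ and every $(x,t)\in R^-$.
   Context: Points of $\mathbb{R}^{n+1}$ are written $(x,t)$ with $x\in\mathbb{R}^n$, $t\in\mathbb{R}$. For $x\in\mathbb{R}^n$, $t\in\mathbb{R}$, $L>0$ let $Q(x,L)=\{y\in\mathbb{R}^n:|y_i-x_i|\le L/2,\ i=1,\dots,n\}$. A parabolic rectangle is a set $R=R(x,t,L)=Q(x,L)\times(t-L^p,t+L^p)$; its upper and lower parts are $R^+=Q(x,L)\times(t,t+L^p)$ and $R^-=Q(x,L)\times(t-L^p,t)$. A weight is a locally integrable nonnegative function on $\mathbb{R}^{n+1}$. $|A|$ is Lebesgue measure, $w(A)=\int_Aw\,dx\,dt$, $w_A=\frac1{|A|}\int_Aw\,dx\,dt$, and $\chi_A$ is the characteristic function of $A$. The inequality in (ii) is understood as $w(E)\le C\frac{|E|}{|R^-|}w(R^+)$. $w\in RH^+_\infty$ means there is a constant $C$ with $\operatorname{ess\,sup}_{R^-}w\le C\,w_{R^+}$ for every parabolic rectangle $R\subset\mathbb{R}^{n+1}$.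 The uncentered forward in time parabolic maximal function is $$M^+f(x,t)=\sup_{P}\frac1{|P^+|}\int_{P^+}|f|\,dy\,ds,$$ the supremum being over all parabolic rectangles $P$ with $(x,t)\in P^-$. *)

theory Defs
  imports "HOL-Analysis.Analysis" "HOL-Probability.Essential_Supremum"
begin

text \<open>
  Points $(x,t)$ of $\mathbb{R}^{n+1}$ are elements of the Euclidean space
  \<^typ>\<open>(real ^ 'n) \<times> real\<close>, where $n$ is the cardinality of the index type \<^typ>\<open>'n::finite\<close>.
  A parabolic rectangle $R(x,t,L)$ is represented by its parameters $x$, $t$ and $L > 0$, and the
  exponent $p$ is an explicit argument. Measures, integrals of nonnegative functions and averages
  take values in \<^typ>\<open>ennreal\<close>, so that a supremum of averages may be infinite.
\<close>

definition cube :: "real ^ 'n \<Rightarrow> real \<Rightarrow> (real ^ 'n) set" where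
  "cube x L = {y. \<forall>i. \<bar>y $ i - x $ i\<bar> \<le> L / 2}"

definition upper_part :: "real \<Rightarrow> real ^ 'n \<Rightarrow> real \<Rightarrow> real \<Rightarrow> ((real ^ 'n) \<times> real) set" where
  "upper_part p x t L = cube x L \<times> {t<..<t + L powr p}"

definition lower_part :: "real \<Rightarrow> real ^ 'n \<Rightarrow> real \<Rightarrow> real \<Rightarrow> ((real ^ 'n) \<times> real) set" where
  "lower_part p x t L = cube x L \<times> {t - L powr p<..<t}"

definition weight :: "((real ^ 'n) \<times> real \<Rightarrow> real) \<Rightarrow> bool" where
  "weight w \<longleftrightarrow> (\<forall>z. 0 \<le> w z) \<and> (\<forall>K. compact K \<longrightarrow> w absolutely_integrable_on K)"

text \<open>
  The next two definitions are meant for nonnegative functions only, since \<^const>\<open>ennreal\<close>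
  truncates negative values to 0.
\<close>

definition weight_of :: "((real ^ 'n) \<times> real \<Rightarrow> real) \<Rightarrow> ((real ^ 'n) \<times> real) set \<Rightarrow> ennreal" where
  "weight_of w A = (\<integral>\<^sup>+ z \<in> A. ennreal (w z) \<partial>lebesgue)"

definition average :: "((real ^ 'n) \<times> real \<Rightarrow> real) \<Rightarrow> ((real ^ 'n) \<times> real) set \<Rightarrow> ennreal" where
  "average w A = weight_of w A / emeasure lebesgue A"

definition RH_infinity_plus :: "real \<Rightarrow> ((real ^ 'n) \<times> real \<Rightarrow> real) \<Rightarrow> bool" where
  "RH_infinity_plus p w \<longleftrightarrow>
    (\<exists>C::real. 0 \<le> C \<and> (\<forall>x t L. 0 < L \<longrightarrow>
      esssup (lebesgue_on (lower_part p x t L)) (\<lambda>z. ennreal (w z))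
        \<le> ennreal C * average w (upper_part p x t L)))"

definition forward_maximal ::
    "real \<Rightarrow> ((real ^ 'n) \<times> real \<Rightarrow> real) \<Rightarrow> (real ^ 'n) \<times> real \<Rightarrow> ennreal" where
  "forward_maximal p f z =
    Sup {average (\<lambda>u. \<bar>f u\<bar>) (upper_part p y s l) | y s l. 0 < l \<and> z \<in> lower_part p y s l}"

end

theory Submission
  imports Defs
begin

text \<open>
  Since $w$ is locally integrable, $c = C\,w_{R^+}$ is finite, and each of the three conditions
  expresses, with the same constant, that $w \le c$ almost everywhere on $R^-$. For (ii), test the
  inequality on $E = \{z \in R^- : w(z) > c\}$. For (iii), the bound on the maximal function gives
  $w(P^+) \le c\,|P^+|$ for every $P^+$ that lies, up to its boundary, inside the interior of $R^-$,
  because $P^-$ then meets $R^-$. An open set is the pointwise limit, as $l \to 0$, of the union of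
  those cells of the grid with side lengths $l$ and $l^p$ that it contains, so Fatou's lemma yields
  $w(V) \le c\,|V|$ for open $V$, and outer regularity extends this to measurable sets. No Lebesgue
  differentiation theorem for parabolic rectangles is needed.
\<close>

text \<open>As a simp rule this would turn \<^term>\<open>emeasure lebesgue\<close> into \<^term>\<open>emeasure lborel\<close> of a main part.\<close>

declare emeasure_completion [simp del]

section \<open>Sets squeezed between an open and a closed box\<close>

lemma box_Pair_eq:
  fixes a b :: "'a::euclidean_space" and c d :: "'b::euclidean_space"
  shows "box (a, c) (b, d) = box a b \<times> box c d"
  by (force simp: box_def Basis_prod_def)

text \<open>The faces of a box are negligible. Different conventions for open and closed faces can
  therefore be exchanged by comparing each set with the same closed box.\<close>

lemma AE_lebesgue_between_boxes:
  fixes a b :: "'a::euclidean_space"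
  assumes "box a b \<subseteq> S" "S \<subseteq> cbox a b"
  shows "AE z in lebesgue. z \<in> S \<longleftrightarrow> z \<in> cbox a b"
proof (rule AE_I')
  show "cbox a b - box a b \<in> null_sets lebesgue"
    using negligible_frontier_interval negligible_iff_null_sets by blast
qed (use assms in auto)

text \<open>\<open>S\<close> is the open box together with a subset of a null set, so completeness
  of Lebesgue measure applies; no Borel structure of \<open>S\<close> is assumed.\<close>

lemma sets_lebesgue_between_boxes:
  fixes a b :: "'a::euclidean_space"
  assumes "box a b \<subseteq> S" "S \<subseteq> cbox a b"
  shows "S \<in> sets lebesgue"
proof -
  have "negligible (S - box a b)"
    using negligible_frontier_interval[of a b] assms by (auto intro: negligible_subset)
  then have "box a b \<union> (S - box a b) \<in> sets lebesgue"
    by (intro sets.Un) (auto simp: negligible_iff_null_sets)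
  moreover have "box a b \<union> (S - box a b) = S"
    using assms by auto
  ultimately show ?thesis by simp
qed

lemma emeasure_lebesgue_between_boxes:
  fixes a b :: "'a::euclidean_space"
  assumes "box a b \<subseteq> S" "S \<subseteq> cbox a b" "\<And>i. i \<in> Basis \<Longrightarrow> a \<bullet> i < b \<bullet> i"
  shows "emeasure lebesgue S = ennreal (\<Prod>i\<in>Basis. (b - a) \<bullet> i)"
proof -
  have "emeasure lebesgue S = emeasure lebesgue (cbox a b)"
    using sets_lebesgue_between_boxes[OF assms(1,2)] AE_lebesgue_between_boxes[OF assms(1,2)]
    by (intro emeasure_eq_AE) auto
  also have "\<dots> = ennreal (\<Prod>i\<in>Basis. (b - a) \<bullet> i)"
    using assms(3) by (simp add: emeasure_completion less_imp_le)
  finally show ?thesis .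
qed

section \<open>Volumes of grid cells and of the parts of parabolic rectangles\<close>

text \<open>The half-open form makes translates tile the space exactly. The base point
  \<open>y\<close> is the lower corner, whereas \<open>upper_part\<close> is parametrized by the
  centre of its cube.\<close>

definition cell :: "real ^ 'n \<Rightarrow> real \<Rightarrow> real \<Rightarrow> real \<Rightarrow> ((real ^ 'n) \<times> real) set" where
  "cell y s l m = {x. \<forall>i. y $ i \<le> x $ i \<and> x $ i < y $ i + l} \<times> {s..<s + m}"

abbreviation slab :: "real ^ 'n \<Rightarrow> real \<Rightarrow> real \<Rightarrow> real \<Rightarrow> ((real ^ 'n) \<times> real) set" where
  "slab y s l m \<equiv> cbox (y, s) (y + (\<chi> i. l), s + m)"

abbreviation open_slab :: "real ^ 'n \<Rightarrow> real \<Rightarrow> real \<Rightarrow> real \<Rightarrow> ((real ^ 'n) \<times> real) set" where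
  "open_slab y s l m \<equiv> box (y, s) (y + (\<chi> i. l), s + m)"

lemma between_slab_volume:
  fixes y :: "real ^ 'n"
  assumes "open_slab y s l m \<subseteq> S" "S \<subseteq> slab y s l m" "0 < l" "0 < m"
  shows "emeasure lebesgue S = ennreal (l ^ CARD('n) * m)"
proof -
  have *: "(\<Prod>i\<in>Basis. ((\<chi> j. l) :: real ^ 'n) \<bullet> i) = l ^ CARD('n)"
    by (simp add: Basis_vec_def UNION_singleton_eq_range prod.reindex inj_on_def axis_eq_axis
      inner_axis)
  have "emeasure lebesgue S
      = ennreal (\<Prod>i\<in>Basis. ((y + (\<chi> i. l), s + m) - (y, s)) \<bullet> i)"
    using assms by (intro emeasure_lebesgue_between_boxes)
      (auto simp: Basis_prod_def Basis_vec_def inner_add_left inner_axis)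
  also have "(\<Prod>i\<in>Basis. ((y + (\<chi> i. l), s + m) - (y, s)) \<bullet> i) = l ^ CARD('n) * m"
    by (simp add: Basis_prod_def prod.union_disjoint[of "(\<lambda>u. (u, 0)) ` Basis"] prod.reindex
      inj_on_def disjoint_iff image_iff * zero_prod_def)
  finally show ?thesis .
qed

lemma cell_between: "open_slab y s l m \<subseteq> cell y s l m" "cell y s l m \<subseteq> slab y s l m"
  unfolding cell_def box_Pair_eq cbox_Pair_eq
  by (auto simp: mem_box_cart less_imp_le)

lemma upper_part_between:
  "open_slab (x - (\<chi> i. L / 2)) t L (L powr p) \<subseteq> upper_part p x t L"
  "upper_part p x t L \<subseteq> slab (x - (\<chi> i. L / 2)) t L (L powr p)"
proof -
  \<comment> \<open>Describes an edge by its lower endpoint \<open>b - L / 2\<close> instead of its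
    centre \<open>b\<close>.\<close>
  have *: "\<bar>a - b\<bar> \<le> L / 2 \<longleftrightarrow> b - L / 2 \<le> a \<and> a \<le> b - L / 2 + L" for a b :: real
    by linarith
  show "open_slab (x - (\<chi> i. L / 2)) t L (L powr p) \<subseteq> upper_part p x t L"
    "upper_part p x t L \<subseteq> slab (x - (\<chi> i. L / 2)) t L (L powr p)"
    unfolding upper_part_def cube_def box_Pair_eq cbox_Pair_eq *
    by (auto simp: mem_box_cart less_imp_le)
qed

lemma lower_part_eq_upper_part: "lower_part p x t L = upper_part p x (t - L powr p) L"
  by (simp add: lower_part_def upper_part_def)

lemma sets_upper_part [measurable, simp]: "upper_part p x t L \<in> sets lebesgue"
  using upper_part_between by (rule sets_lebesgue_between_boxes)

lemma sets_lower_part [measurable, simp]: "lower_part p x t L \<in> sets lebesgue"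
  by (simp add: lower_part_eq_upper_part)

lemma emeasure_upper_part:
  fixes x :: "real ^ 'n"
  assumes "0 < L"
  shows "emeasure lebesgue (upper_part p x t L) = ennreal (L ^ CARD('n) * L powr p)"
  using assms by (intro between_slab_volume[OF upper_part_between]) auto

lemma emeasure_lower_part:
  fixes x :: "real ^ 'n"
  assumes "0 < L"
  shows "emeasure lebesgue (lower_part p x t L) = ennreal (L ^ CARD('n) * L powr p)"
  using assms by (simp add: lower_part_eq_upper_part emeasure_upper_part)

section \<open>Measurability and local finiteness of weights\<close>

lemma weight_nonneg: "weight w \<Longrightarrow> 0 \<le> w z"
  unfolding weight_def by blast

text \<open>Integrability on compact sets gives measurability of the truncations to balls of radius
  \<open>N\<close>. At each point these are eventually equal to \<open>w\<close>.\<close>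

lemma weight_measurable:
  fixes w :: "(real ^ 'n) \<times> real \<Rightarrow> real"
  assumes "weight w"
  shows "w \<in> borel_measurable lebesgue"
proof (rule borel_measurable_LIMSEQ_real)
  fix N :: nat
  have "w absolutely_integrable_on cball 0 (real N)"
    using assms by (simp add: weight_def)
  then show "(\<lambda>z. indicat_real (cball 0 (real N)) z *\<^sub>R w z) \<in> borel_measurable lebesgue"
    unfolding set_integrable_def by (rule borel_measurable_integrable)
next
  fix z :: "(real ^ 'n) \<times> real"
  obtain M where M: "norm z \<le> real M"
    using real_arch_simple by blast
  have "\<forall>\<^sub>F N in sequentially. indicat_real (cball 0 (real N)) z *\<^sub>R w z = w z"
    using eventually_ge_at_top[of M]
    by eventually_elim (use M in \<open>auto simp: indicator_def\<close>)
  then show "(\<lambda>N. indicat_real (cball 0 (real N)) z *\<^sub>R w z) \<longlonglongrightarrow> w z"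
    by (rule tendsto_eventually)
qed

lemma weight_of_mono: "A \<subseteq> B \<Longrightarrow> weight_of w A \<le> weight_of w B"
  unfolding weight_of_def by (intro nn_integral_mono) (auto simp: indicator_def)

lemma weight_of_compact_finite:
  assumes "weight w" "compact K"
  shows "weight_of w K < \<infinity>"
proof -
  have "integrable lebesgue (\<lambda>z. indicat_real K z *\<^sub>R w z)"
    using assms by (simp add: weight_def set_integrable_def)
  then have "(\<integral>\<^sup>+ z. ennreal (indicat_real K z *\<^sub>R w z) \<partial>lebesgue) < \<infinity>"
    using integrableD(2)[of lebesgue "\<lambda>z. indicat_real K z *\<^sub>R w z"] weight_nonneg[OF assms(1)]
    by (simp add: less_top)
  also have "(\<integral>\<^sup>+ z. ennreal (indicat_real K z *\<^sub>R w z) \<partial>lebesgue) = weight_of w K"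
    unfolding weight_of_def by (intro nn_integral_cong) (auto simp: indicator_def)
  finally show ?thesis .
qed

lemma weight_of_upper_part_finite:
  assumes "weight w"
  shows "weight_of w (upper_part p x t L) < \<infinity>"
  using weight_of_mono[OF upper_part_between(2)] weight_of_compact_finite[OF assms compact_cbox]
  by (rule le_less_trans)

text \<open>An upper part lies in a compact box and has positive volume. This is what makes the
  bound \<open>c\<close> finite in all later applications.\<close>

lemma average_upper_part_finite:
  assumes "weight w" "0 < L"
  shows "average w (upper_part p x t L) < \<infinity>"
  using weight_of_upper_part_finite[OF assms(1), of p x t L] assms(2)
  by (auto simp: average_def emeasure_upper_part ennreal_divide_eq_top_iff
    simp flip: top.not_eq_extremum)

section \<open>Almost everywhere bounds, essential suprema and averages\<close>

text \<open>Integrating the pointwise bound gives one direction. For the other, the superlevel set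
  of \<open>f\<close> in \<open>A\<close> violates the integral bound unless it is null; finiteness
  of \<open>c\<close> and of the measure of \<open>A\<close> is what makes the comparison of
  integrals strict.\<close>

lemma weight_of_le_iff_AE:
  assumes f: "f \<in> borel_measurable lebesgue"
    and A: "A \<in> sets lebesgue" "emeasure lebesgue A < \<infinity>" and c: "c < \<infinity>"
  shows "(\<forall>E\<in>sets lebesgue. E \<subseteq> A \<longrightarrow> weight_of f E \<le> c * emeasure lebesgue E)
    \<longleftrightarrow> (AE z in lebesgue. z \<in> A \<longrightarrow> ennreal (f z) \<le> c)"
proof
  assume le: "\<forall>E\<in>sets lebesgue. E \<subseteq> A \<longrightarrow> weight_of f E \<le> c * emeasure lebesgue E"
  define E where "E = {z \<in> A. c < ennreal (f z)}"
  have [measurable]: "f \<in> borel_measurable lebesgue" "A \<in> sets lebesgue"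
    using f A by auto
  have "E = {z \<in> space lebesgue. z \<in> A \<and> c < ennreal (f z)}"
    by (auto simp: E_def)
  also have "\<dots> \<in> sets lebesgue"
    by measurable
  finally have E [measurable]: "E \<in> sets lebesgue" .
  have "emeasure lebesgue E < \<infinity>"
    using emeasure_mono[of E A lebesgue] A by (auto simp: E_def intro: le_less_trans)
  then have fin: "(\<integral>\<^sup>+ z. c * indicator E z \<partial>lebesgue) < \<infinity>"
    using c by (simp add: nn_integral_cmult_indicator ennreal_mult_less_top)
  have "AE z in lebesgue. ennreal (f z) * indicator E z \<le> c * indicator E z"
  \<comment> \<open>On \<open>E\<close> the function exceeds \<open>c\<close>, so
    \<open>c * indicator E\<close> is the smaller function everywhere. If the reverse inequality
    fails on a set of positive measure, the integrals differ strictly, because the smaller one is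
    finite.\<close>
  proof (rule ccontr)
    assume "\<not> ?thesis"
    then have "(\<integral>\<^sup>+ z. c * indicator E z \<partial>lebesgue) < weight_of f E"
      unfolding weight_of_def using fin
      by (intro nn_integral_less) (auto simp: E_def indicator_def)
    moreover have "weight_of f E \<le> (\<integral>\<^sup>+ z. c * indicator E z \<partial>lebesgue)"
      using le by (auto simp: nn_integral_cmult_indicator E_def)
    ultimately show False by simp
  qed
  then show "AE z in lebesgue. z \<in> A \<longrightarrow> ennreal (f z) \<le> c"
    by eventually_elim (metis (mono_tags, lifting) E_def indicator_simps(1) linorder_not_less
      mem_Collect_eq mult.right_neutral)
next
  assume ae: "AE z in lebesgue. z \<in> A \<longrightarrow> ennreal (f z) \<le> c"
  show "\<forall>E\<in>sets lebesgue. E \<subseteq> A \<longrightarrow> weight_of f E \<le> c * emeasure lebesgue E"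
  proof (intro ballI impI)
    fix E assume E: "E \<in> sets lebesgue" "E \<subseteq> A"
    have "weight_of f E \<le> (\<integral>\<^sup>+ z. c * indicator E z \<partial>lebesgue)"
      unfolding weight_of_def using ae
      by (intro nn_integral_mono_AE, eventually_elim) (use E in \<open>auto simp: indicator_def\<close>)
    also have "\<dots> = c * emeasure lebesgue E"
      using E by (simp add: nn_integral_cmult_indicator)
    finally show "weight_of f E \<le> c * emeasure lebesgue E" .
  qed
qed

lemma esssup_le_iff_AE:
  assumes "f \<in> borel_measurable lebesgue" "A \<in> sets lebesgue"
  shows "esssup (lebesgue_on A) (\<lambda>z. ennreal (f z)) \<le> c
    \<longleftrightarrow> (AE z in lebesgue. z \<in> A \<longrightarrow> ennreal (f z) \<le> c)"
proof -
  have "esssup (lebesgue_on A) (\<lambda>z. ennreal (f z)) \<le> c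
      \<longleftrightarrow> (AE z in lebesgue_on A. ennreal (f z) \<le> c)"
  proof
    assume "esssup (lebesgue_on A) (\<lambda>z. ennreal (f z)) \<le> c"
    then show "AE z in lebesgue_on A. ennreal (f z) \<le> c"
      using esssup_AE[of "\<lambda>z. ennreal (f z)" "lebesgue_on A"] by (auto elim: order_trans)
  next
    assume "AE z in lebesgue_on A. ennreal (f z) \<le> c"
    then show "esssup (lebesgue_on A) (\<lambda>z. ennreal (f z)) \<le> c"
      using assms by (intro esssup_I measurable_restrict_space1) auto
  qed
  also have "\<dots> \<longleftrightarrow> (AE z in lebesgue. z \<in> A \<longrightarrow> ennreal (f z) \<le> c)"
    using assms by (intro AE_restrict_space_iff) auto
  finally show ?thesis .
qed

text \<open>The hypotheses exclude the degenerate quotients by 0 and by \<infinity> in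
  \<open>ennreal\<close>, so the denominator can be cleared.\<close>

lemma average_le_iff:
  assumes "0 < emeasure lebesgue A" "emeasure lebesgue A < \<infinity>"
  shows "average f A \<le> c \<longleftrightarrow> weight_of f A \<le> c * emeasure lebesgue A"
proof
  assume "average f A \<le> c"
  then have "average f A * emeasure lebesgue A \<le> c * emeasure lebesgue A"
    by (rule mult_right_mono) simp
  then show "weight_of f A \<le> c * emeasure lebesgue A"
    using assms by (simp add: average_def ennreal_divide_times flip: ennreal_times_divide)
next
  assume "weight_of f A \<le> c * emeasure lebesgue A"
  then show "average f A \<le> c"
    using assms by (simp add: average_def divide_le_posI_ennreal mult.commute)
qed

text \<open>Makes countable additivity of measures available for \<open>weight_of\<close>.\<close>

lemma weight_of_eq_emeasure_density:
  assumes "f \<in> borel_measurable lebesgue" "A \<in> sets lebesgue"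
  shows "weight_of f A = emeasure (density lebesgue (\<lambda>z. ennreal (f z))) A"
  using assms by (simp add: weight_of_def emeasure_density)

section \<open>From grid cells to open sets and then to measurable sets\<close>

lemma sets_cell [measurable, simp]: "cell y s l m \<in> sets lebesgue"
  using cell_between by (rule sets_lebesgue_between_boxes)

text \<open>The Euclidean norm is at most the sum of the coordinates in absolute value. This crude
  bound suffices, since it tends to 0 with \<open>l\<close> and \<open>m\<close>.\<close>

lemma dist_cell_le:
  fixes y :: "real ^ 'n"
  assumes "z \<in> cell y s l m" "z' \<in> cell y s l m"
  shows "dist z z' \<le> real CARD('n) * l + m"
proof -
  obtain x t x' t' where z: "z = (x, t)" "z' = (x', t')"
    by (metis surj_pair)
  have "\<bar>(x - x') $ i\<bar> \<le> l" for i
    using assms unfolding z cell_def by (auto simp: abs_le_iff) (smt (verit))+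
  then have "(\<Sum>i\<in>UNIV. \<bar>(x - x') $ i\<bar>) \<le> real CARD('n) * l"
    using sum_bounded_above[of UNIV "\<lambda>i. \<bar>(x - x') $ i\<bar>" l] by simp
  then have "norm (x - x') \<le> real CARD('n) * l"
    using norm_le_l1_cart order_trans by blast
  moreover have "norm (t - t') \<le> m"
    using assms unfolding z cell_def by (auto simp: abs_le_iff)
  moreover have "dist z z' \<le> norm (x - x') + norm (t - t')"
    using norm_Pair_le[of "x - x'" "t - t'"] by (simp add: z dist_norm)
  ultimately show ?thesis by linarith
qed

text \<open>The index of the cell containing a point is read off by floors, so it exists and is
  unique: the grid both covers the space and is disjoint.\<close>

lemma mem_grid_cell_iff:
  fixes x :: "real ^ 'n" and k :: "int ^ 'n"
  assumes "0 < l" "0 < m"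
  shows "(x, t) \<in> cell (\<chi> i. l * of_int (k $ i)) (m * of_int j) l m
    \<longleftrightarrow> (\<chi> i. \<lfloor>x $ i / l\<rfloor>) = k \<and> \<lfloor>t / m\<rfloor> = j"
  using assms by (auto simp: cell_def vec_eq_iff floor_eq_iff field_simps)

text \<open>The grids for successive \<open>N\<close> are not nested, so \<open>V N\<close> need not
  increase with \<open>N\<close>. Each point of \<open>U\<close> is nevertheless in
  \<open>V N\<close> for all large \<open>N\<close>, which is all that Fatou's lemma
  requires.\<close>

lemma weight_of_open_le:
  fixes f :: "(real ^ 'n) \<times> real \<Rightarrow> real"
  assumes f: "f \<in> borel_measurable lebesgue" and p: "0 < p" and U: "open U"
    and cells: "\<And>y s l. 0 < l \<Longrightarrow> cell y s l (l powr p) \<subseteq> U \<Longrightarrow>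
      weight_of f (cell y s l (l powr p)) \<le> c * emeasure lebesgue (cell y s l (l powr p))"
  shows "weight_of f U \<le> c * emeasure lebesgue U"
proof -
  define l where "l N = 1 / real (Suc N)" for N
  define m where "m N = l N powr p" for N
  define G where "G N k = cell (\<chi> i. l N * of_int (fst k $ i)) (m N * of_int (snd k)) (l N) (m N)"
    for N and k :: "(int ^ 'n) \<times> int"
  define V where "V N = (\<Union>k\<in>{k. G N k \<subseteq> U}. G N k)" for N
  have l: "0 < l N" and m: "0 < m N" for N
    by (auto simp: l_def m_def)
  have G_iff: "z \<in> G N k \<longleftrightarrow> ((\<chi> i. \<lfloor>fst z $ i / l N\<rfloor>), \<lfloor>snd z / m N\<rfloor>) = k" for z N k
    using mem_grid_cell_iff[OF l m, of "fst z" "snd z" N "fst k" N "snd k"]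
    by (simp add: G_def prod_eq_iff)
  have [measurable, simp]: "G N k \<in> sets lebesgue" for N k
    by (simp add: G_def)
  have V [measurable]: "V N \<in> sets lebesgue" for N
    unfolding V_def by (intro sets.countable_UN') auto
  have disj: "disjoint_family_on (G N) {k. G N k \<subseteq> U}" for N
    by (auto simp: disjoint_family_on_def G_iff)
  have U' [measurable]: "U \<in> sets lebesgue"
    using U by (simp add: borel_open)
  have V_le: "weight_of f (V N) \<le> c * emeasure lebesgue U" for N
  proof -
    \<comment> \<open>The indices are integer vectors, hence countable, and the sum over the
      disjoint cells is an integral over a counting measure.\<close>
    have "weight_of f (V N) = (\<integral>\<^sup>+ k. weight_of f (G N k) \<partial>count_space {k. G N k \<subseteq> U})"
      using f V disj
      by (simp add: weight_of_eq_emeasure_density V_def emeasure_UN_countable)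
    also have "\<dots> \<le> (\<integral>\<^sup>+ k. c * emeasure lebesgue (G N k) \<partial>count_space {k. G N k \<subseteq> U})"
      using cells l by (intro nn_integral_mono) (auto simp: G_def m_def)
    also have "\<dots> = c * emeasure lebesgue (V N)"
      using disj by (simp add: nn_integral_cmult V_def emeasure_UN_countable)
    also have "\<dots> \<le> c * emeasure lebesgue U"
      by (intro mult_left_mono emeasure_mono) (auto simp: V_def)
    finally show ?thesis .
  qed
  have size: "(\<lambda>N. real CARD('n) * l N + m N) \<longlonglongrightarrow> 0"
  proof -
    have l0: "l \<longlonglongrightarrow> 0"
      unfolding l_def using LIMSEQ_inverse_real_of_nat by (simp add: inverse_eq_divide)
    moreover have "m \<longlonglongrightarrow> 0"
      unfolding m_def using l0 p l
      by (intro tendsto_zero_powrI[OF _ tendsto_const]) (auto simp: less_imp_le)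
    ultimately show ?thesis
      by (auto intro!: tendsto_eq_intros)
  qed
  have in_V: "\<forall>\<^sub>F N in sequentially. z \<in> V N" if "z \<in> U" for z
  proof -
    obtain e where e: "0 < e" "ball z e \<subseteq> U"
      using U \<open>z \<in> U\<close> openE by blast
    show ?thesis
      \<comment> \<open>Once the diameter bound drops below \<open>e\<close>, the cell containing
        \<open>z\<close> lies in \<open>ball z e\<close>, hence in \<open>U\<close>, and is one of
        those forming \<open>V N\<close>.\<close>
      using order_tendstoD(2)[OF size e(1)]
    proof eventually_elim
      case (elim N)
      define k where "k = ((\<chi> i. \<lfloor>fst z $ i / l N\<rfloor>), \<lfloor>snd z / m N\<rfloor>)"
      have z: "z \<in> G N k"
        by (simp add: G_iff k_def)
      have "G N k \<subseteq> ball z e"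
      proof
        fix z'
        assume "z' \<in> G N k"
        then have "dist z z' \<le> real CARD('n) * l N + m N"
          using z unfolding G_def by (intro dist_cell_le)
        then show "z' \<in> ball z e"
          using elim by simp
      qed
      then show ?case
        using e z unfolding V_def by blast
    qed
  qed
  have "weight_of f U \<le> (\<integral>\<^sup>+ z. liminf (\<lambda>N. ennreal (f z) * indicator (V N) z) \<partial>lebesgue)"
    unfolding weight_of_def
  proof (intro nn_integral_mono)
    fix z :: "(real ^ 'n) \<times> real"
    have "ennreal (f z) * indicator U z \<le> liminf (\<lambda>N. ennreal (f z) * indicator (V N) z)" if "z \<in> U"
    proof (rule Liminf_bounded)
      show "\<forall>\<^sub>F N in sequentially. ennreal (f z) * indicator U z \<le> ennreal (f z) * indicator (V N) z"
        using in_V[OF that] by eventually_elim (simp add: that)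
    qed
    then show "ennreal (f z) * indicator U z \<le> liminf (\<lambda>N. ennreal (f z) * indicator (V N) z)"
      by (cases "z \<in> U") auto
  qed
  also have "\<dots> \<le> liminf (\<lambda>N. weight_of f (V N))"
    unfolding weight_of_def using f V
    by (intro nn_integral_liminf borel_measurable_times_ennreal borel_measurable_indicator) auto
  also have "\<dots> \<le> liminf (\<lambda>N::nat. c * emeasure lebesgue U)"
    using V_le by (intro Liminf_mono) auto
  also have "\<dots> = c * emeasure lebesgue U"
    by (simp add: Liminf_const)
  finally show ?thesis .
qed

text \<open>\<open>E\<close> is approximated from outside by open sets; as \<open>c\<close> is
  finite, a small excess in measure costs only a small excess in the bound.\<close>

lemma weight_of_le_outer_regular:
  fixes c :: ennreal
  assumes c: "c < \<infinity>" and U: "open U"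
    and le: "\<And>V. open V \<Longrightarrow> V \<subseteq> U \<Longrightarrow> weight_of f V \<le> c * emeasure lebesgue V"
    and E: "E \<in> sets lebesgue" "E \<subseteq> U"
  shows "weight_of f E \<le> c * emeasure lebesgue E"
proof (rule ennreal_le_epsilon)
  fix e :: real
  assume "0 < e"
  obtain r where r: "0 \<le> r" "c = ennreal r"
    using c by (cases c) auto
  \<comment> \<open>The summand 1 keeps the quotient meaningful when \<open>r = 0\<close>.\<close>
  define d where "d = e / (r + 1)"
  have d: "0 < d" "r * d \<le> e"
    using \<open>0 < e\<close> r by (auto simp: d_def field_simps)
  obtain T where T: "open T" "E \<subseteq> T" "T - E \<in> lmeasurable" "emeasure lebesgue (T - E) < ennreal d"
    using sets_lebesgue_outer_open[OF E(1) d(1)] .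
  \<comment> \<open>The open set \<open>T\<close> may leave \<open>U\<close>, where
    \<open>le\<close> says nothing, so it is cut back to \<open>U\<close>.\<close>
  have "weight_of f E \<le> weight_of f (T \<inter> U)"
    using T E by (intro weight_of_mono) auto
  also have "\<dots> \<le> c * emeasure lebesgue (T \<inter> U)"
    using T U by (intro le) auto
  also have "\<dots> \<le> c * emeasure lebesgue (E \<union> (T - E))"
    using T E by (intro mult_left_mono emeasure_mono) (auto simp: fmeasurableD)
  also have "\<dots> \<le> c * (emeasure lebesgue E + emeasure lebesgue (T - E))"
    using T E by (intro mult_left_mono emeasure_subadditive) (auto simp: fmeasurableD)
  also have "\<dots> \<le> c * (emeasure lebesgue E + ennreal d)"
    using T by (intro mult_left_mono add_left_mono) auto
  also have "\<dots> = c * emeasure lebesgue E + ennreal (r * d)"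
    using r d by (simp add: distrib_left ennreal_mult)
  also have "\<dots> \<le> c * emeasure lebesgue E + ennreal e"
    using d by (intro add_left_mono ennreal_leI) auto
  finally show "weight_of f E \<le> c * emeasure lebesgue E + ennreal e" .
qed

section \<open>Bounds on the forward maximal function and bounds almost everywhere\<close>

text \<open>Up to a null set the cell is \<open>P^+\<close> for the rectangle \<open>P\<close>
  centred at \<open>y + (\<chi> i. l / 2)\<close> and time \<open>s\<close>. A point just below the
  corner \<open>(y, s)\<close> lies in both \<open>P^-\<close> and \<open>R^-\<close>, and the
  maximal function there dominates the average over \<open>P^+\<close>.\<close>

lemma weight_of_cell_le_forward_maximal:
  fixes w :: "(real ^ 'n) \<times> real \<Rightarrow> real"
  assumes w: "weight w" and l: "0 < l"
    and sub: "cell y s l (l powr p) \<subseteq> lower_part p x t L"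
    and le: "\<And>z. z \<in> lower_part p x t L \<Longrightarrow>
      forward_maximal p (\<lambda>u. w u * indicator (lower_part p x t L) u) z \<le> c"
  shows "weight_of w (cell y s l (l powr p)) \<le> c * emeasure lebesgue (cell y s l (l powr p))"
proof -
  let ?Q = "cell y s l (l powr p)" and ?R = "lower_part p x t L"
  let ?P = "upper_part p (y + (\<chi> i. l / 2)) s l"
  let ?g = "\<lambda>u. \<bar>w u * indicator ?R u\<bar>"
  have "(y, s) \<in> ?Q"
    using l by (simp add: cell_def)
  then have ys: "y \<in> cube x L" "t - L powr p < s" "s < t"
    using sub by (auto simp: lower_part_def)
  moreover have "s - l powr p < s"
    using l by simp
  \<comment> \<open>The time interval of \<open>R^-\<close> is open and contains \<open>s\<close>,
    so there is room below \<open>s\<close> for a time that also belongs to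
    \<open>P^-\<close>.\<close>
  ultimately obtain r where "max (t - L powr p) (s - l powr p) < r" "r < s"
    by (meson dense max_less_iff_conj)
  then have r: "t - L powr p < r" "r < t" "s - l powr p < r" "r < s"
    using ys by simp_all
  have "(y, r) \<in> ?R"
    using ys r by (simp add: lower_part_def)
  \<comment> \<open>In space, \<open>y\<close> is a corner of the cube of \<open>P\<close>, so
    closedness of \<open>cube\<close> matters here.\<close>
  moreover have "(y, r) \<in> lower_part p (y + (\<chi> i. l / 2)) s l"
    using r l by (simp add: lower_part_def cube_def)
  then have "average ?g ?P \<le> forward_maximal p (\<lambda>u. w u * indicator ?R u) (y, r)"
    unfolding forward_maximal_def using l by (intro Sup_upper) blast
  ultimately have avg: "average ?g ?P \<le> c"
    using le order_trans by blast
  have vol: "emeasure lebesgue ?P = emeasure lebesgue ?Q"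
    using l by (simp add: emeasure_upper_part between_slab_volume[OF cell_between])
  have between: "open_slab y s l (l powr p) \<subseteq> ?P" "?P \<subseteq> slab y s l (l powr p)"
    using upper_part_between[where x = "y + (\<chi> i. l / 2)" and L = l and t = s and p = p] by simp_all
  \<comment> \<open>The cell lies in \<open>R^-\<close>, so neither the cutoff nor the absolute
    value changes \<open>w\<close> on it; \<open>?P\<close> and \<open>?Q\<close> differ only in
    boundary faces.\<close>
  have "weight_of w ?Q = weight_of ?g ?P"
    unfolding weight_of_def
  proof (rule nn_integral_cong_AE)
    show "AE z in lebesgue. ennreal (w z) * indicator ?Q z = ennreal (?g z) * indicator ?P z"
      using AE_lebesgue_between_boxes[OF between]
        AE_lebesgue_between_boxes[OF cell_between, of y s l "l powr p"]
    proof eventually_elim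
      case (elim z)
      then show ?case
        using sub weight_nonneg[OF w, of z] by (auto simp: indicator_def)
    qed
  qed
  also have "\<dots> \<le> c * emeasure lebesgue ?P"
    using avg l by (subst (asm) average_le_iff) (auto simp: emeasure_upper_part)
  finally show ?thesis
    by (simp add: vol)
qed

text \<open>The bound on cells passes to open and then to measurable subsets of the open box inside
  \<open>R^-\<close>; the rest of \<open>R^-\<close> is a null set.\<close>

lemma AE_le_of_forward_maximal_le:
  fixes w :: "(real ^ 'n) \<times> real \<Rightarrow> real"
  assumes w: "weight w" and p: "0 < p" and c: "c < \<infinity>"
    and le: "\<And>z. z \<in> lower_part p x t L \<Longrightarrow>
      forward_maximal p (\<lambda>u. w u * indicator (lower_part p x t L) u) z \<le> c"
  shows "AE z in lebesgue. z \<in> lower_part p x t L \<longrightarrow> ennreal (w z) \<le> c"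
proof -
  define a where "a = x - (\<chi> i. L / 2)"
  define s where "s = t - L powr p"
  let ?R = "lower_part p x t L" and ?U = "open_slab a s L (L powr p)"
  have R: "?U \<subseteq> ?R" "?R \<subseteq> slab a s L (L powr p)"
    unfolding a_def s_def lower_part_eq_upper_part by (rule upper_part_between)+
  have "weight_of w V \<le> c * emeasure lebesgue V" if "open V" "V \<subseteq> ?U" for V
    using weight_measurable[OF w] p that(1)
  proof (rule weight_of_open_le)
    fix y and r l :: real
    assume "0 < l" "cell y r l (l powr p) \<subseteq> V"
    then show "weight_of w (cell y r l (l powr p)) \<le> c * emeasure lebesgue (cell y r l (l powr p))"
      using that R by (intro weight_of_cell_le_forward_maximal[OF w _ _ le]) auto
  qed
  moreover have fin: "emeasure lebesgue ?U < \<infinity>"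
    using emeasure_lborel_box_finite by (simp add: emeasure_completion)
  ultimately have "\<forall>E\<in>sets lebesgue. E \<subseteq> ?U \<longrightarrow> weight_of w E \<le> c * emeasure lebesgue E"
    using weight_of_le_outer_regular[OF c open_box] by blast
  then have "AE z in lebesgue. z \<in> ?U \<longrightarrow> ennreal (w z) \<le> c"
    using c fin by (subst (asm) weight_of_le_iff_AE[OF weight_measurable[OF w]])
      auto
  then show ?thesis
    using AE_lebesgue_between_boxes[OF R] AE_lebesgue_between_boxes[OF order_refl box_subset_cbox]
    by eventually_elim auto
qed

text \<open>The function cut off to \<open>A\<close> vanishes elsewhere, so it is at most
  \<open>c\<close> almost everywhere on the whole space, and so is each of its averages.\<close>

lemma forward_maximal_le_of_AE_le:
  fixes w :: "(real ^ 'n) \<times> real \<Rightarrow> real"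
  assumes w: "weight w" and ae: "AE z in lebesgue. z \<in> A \<longrightarrow> ennreal (w z) \<le> c"
  shows "forward_maximal p (\<lambda>u. w u * indicator A u) z \<le> c"
  unfolding forward_maximal_def
proof (rule Sup_least, clarify)
  fix y :: "real ^ 'n" and s l :: real
  assume l: "0 < l"
  let ?g = "\<lambda>u. \<bar>w u * indicator A u\<bar>" and ?P = "upper_part p y s l"
  have "weight_of ?g ?P \<le> (\<integral>\<^sup>+ u. c * indicator ?P u \<partial>lebesgue)"
    unfolding weight_of_def
    using ae by (intro nn_integral_mono_AE, eventually_elim)
      (auto simp: indicator_def weight_nonneg[OF w])
  also have "\<dots> = c * emeasure lebesgue ?P"
    by (simp add: nn_integral_cmult_indicator)
  finally show "average ?g ?P \<le> c"
    using l by (subst average_le_iff) (auto simp: emeasure_upper_part)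
qed

section \<open>The two equivalences\<close>

text \<open>The equivalence already holds for each fixed constant and rectangle, both sides saying
  that \<open>w\<close> is at most \<open>?c\<close> almost everywhere on the lower part.\<close>

lemma RH_infinity_plus_iff_weight_of:
  fixes w :: "(real ^ 'n) \<times> real \<Rightarrow> real"
  assumes w: "weight w"
  shows "RH_infinity_plus p w \<longleftrightarrow>
      (\<exists>C::real. 0 \<le> C \<and> (\<forall>x t L. 0 < L \<longrightarrow>
        (\<forall>E \<in> sets lebesgue. E \<subseteq> lower_part p x t L \<longrightarrow>
          weight_of w E \<le> ennreal C * (emeasure lebesgue E / emeasure lebesgue (lower_part p x t L))
            * weight_of w (upper_part p x t L))))"
proof -
  have "esssup (lebesgue_on (lower_part p x t L)) (\<lambda>z. ennreal (w z))
        \<le> ennreal C * average w (upper_part p x t L)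
      \<longleftrightarrow> (\<forall>E \<in> sets lebesgue. E \<subseteq> lower_part p x t L \<longrightarrow>
          weight_of w E \<le> ennreal C * (emeasure lebesgue E / emeasure lebesgue (lower_part p x t L))
            * weight_of w (upper_part p x t L))" if L: "0 < L" for C x t L
  proof -
    let ?c = "ennreal C * average w (upper_part p x t L)"
    \<comment> \<open>The upper and lower parts have equal volume, so the denominator can be moved
      from \<open>E\<close> to the weight of the upper part, forming its average.\<close>
    have "ennreal C * (emeasure lebesgue E / emeasure lebesgue (lower_part p x t L))
        * weight_of w (upper_part p x t L) = ?c * emeasure lebesgue E"
      for E :: "((real ^ 'n) \<times> real) set"
      using L by (simp add: average_def emeasure_lower_part emeasure_upper_part
        divide_ennreal_def ac_simps)
    moreover have "?c < \<infinity>"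
      using average_upper_part_finite[OF w L] by (simp add: ennreal_mult_less_top)
    moreover have "emeasure lebesgue (lower_part p x t L) < \<infinity>"
      using L by (simp add: emeasure_lower_part)
    ultimately show ?thesis
      by (simp only: esssup_le_iff_AE[OF weight_measurable[OF w] sets_lower_part]
        weight_of_le_iff_AE[OF weight_measurable[OF w] sets_lower_part])
  qed
  then show ?thesis
    unfolding RH_infinity_plus_def by auto
qed

text \<open>Again constant by constant and rectangle by rectangle, through the almost everywhere
  bound on the lower part.\<close>

lemma RH_infinity_plus_iff_forward_maximal:
  fixes w :: "(real ^ 'n) \<times> real \<Rightarrow> real"
  assumes w: "weight w" and p: "0 < p"
  shows "RH_infinity_plus p w \<longleftrightarrow>
      (\<exists>C::real. 0 \<le> C \<and> (\<forall>x t L. 0 < L \<longrightarrow>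
        (\<forall>z \<in> lower_part p x t L.
          forward_maximal p (\<lambda>u. w u * indicator (lower_part p x t L) u) z
            \<le> ennreal C * average w (upper_part p x t L))))"
proof -
  have "esssup (lebesgue_on (lower_part p x t L)) (\<lambda>z. ennreal (w z))
        \<le> ennreal C * average w (upper_part p x t L)
      \<longleftrightarrow> (\<forall>z \<in> lower_part p x t L.
          forward_maximal p (\<lambda>u. w u * indicator (lower_part p x t L) u) z
            \<le> ennreal C * average w (upper_part p x t L))" if L: "0 < L" for C x t L
  proof -
    have "ennreal C * average w (upper_part p x t L) < \<infinity>"
      using average_upper_part_finite[OF w L] by (simp add: ennreal_mult_less_top)
    then show ?thesis
      unfolding esssup_le_iff_AE[OF weight_measurable[OF w] sets_lower_part]
      using AE_le_of_forward_maximal_le[OF w p] forward_maximal_le_of_AE_le[OF w] by blast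
  qed
  then show ?thesis
    unfolding RH_infinity_plus_def by auto
qed

theorem proposition2p4:
  fixes p :: real and w :: "(real ^ 'n) \<times> real \<Rightarrow> real"
  assumes "1 < p" and "weight w"
  shows "(RH_infinity_plus p w \<longleftrightarrow>
      (\<exists>C::real. 0 \<le> C \<and> (\<forall>x t L. 0 < L \<longrightarrow>
        (\<forall>E \<in> sets lebesgue. E \<subseteq> lower_part p x t L \<longrightarrow>
          weight_of w E \<le> ennreal C * (emeasure lebesgue E / emeasure lebesgue (lower_part p x t L))
            * weight_of w (upper_part p x t L)))))
    \<and> (RH_infinity_plus p w \<longleftrightarrow>
      (\<exists>C::real. 0 \<le> C \<and> (\<forall>x t L. 0 < L \<longrightarrow>
        (\<forall>z \<in> lower_part p x t L.
          forward_maximal p (\<lambda>u. w u * indicator (lower_part p x t L) u) z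
            \<le> ennreal C * average w (upper_part p x t L)))))"
  using assms
  by (intro conjI RH_infinity_plus_iff_weight_of RH_infinity_plus_iff_forward_maximal) auto

end
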